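(* Let $\mathbb{D}=\{z\in\mathbb{C}:|z|<1\}$ and let $f=h+\overline{g}$ be a sense-preserving univalent harmonic mapping of $\mathbb{D}$ with $h(z)=z+\sum_{n=2}^\infty a_nz^n$ and $g(z)=\sum_{n=2}^\infty b_nz^n$ (so $f\in\mathcal{S}^0_H$), which is stable convex, i.e. $h+\mu\overline{g}$ is univalent and convex in $\mathbb{D}$ for every $|\mu|=1$. Let $m,p\in\mathbb{N}$, $\omega_m\in\mathcal{B}_m$, $\omega_p\in\mathcal{B}_p$, and let $N\ge2$ be an integer. Then $$|D^2f(\omega_m(z))|+\sum_{n=N}^{\infty}(|a_n|+|b_n|)|\omega_p(z)|^n\le d\big(f(0),\partial f(\mathbb{D})\big)\quad\text{and}\quad|\mathscr{D}^2f(\omega_m(z))|+\sum_{n=N}^{\infty}(|a_n|+|b_n|)|\omega_p(z)|^n\le d\big(f(0),\partial f(\mathbb{D})\big)$$ both hold for $|z|=r\le r_{8,m,p}$, where $r_{8,m,p}$ is the unique root in $(0,1)$ of $$\frac{r^m(1+r^m)}{(1-r^m)^3}+\frac{r^{pN}}{1-r^p}-\frac12=0.$$ The radius $r_{8,m,p}$ is best possible.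
   Context: For $n\in\mathbb{N}$, $\mathcal{B}_n$ denotes the set of analytic functions $\omega:\mathbb{D}\to\mathbb{C}$ with $|\omega(z)|\le1$ in $\mathbb{D}$, $\omega(0)=\omega'(0)=\cdots=\omega^{(n-1)}(0)=0$ and $\omega^{(n)}(0)\neq0$. For a harmonic $f$, $Df=zf_z-\overline{z}f_{\overline{z}}$ and $\mathscr{D}f=zf_z+\overline{z}f_{\overline{z}}$; $D^2f=D(Df)$ and $\mathscr{D}^2f=\mathscr{D}(\mathscr{D}f)$, and $D^2f(\omega_m(z))$ means $(D^2f)(\omega_m(z))$ (similarly for $\mathscr{D}^2$). $d(f(0),\partial f(\mathbb{D}))$ is the Euclidean distance from $f(0)$ to the boundary of $f(\mathbb{D})$. "Best possible" means that for every $r>r_{8,m,p}$ there exist such $f,\omega_m,\omega_p$ and $z$ with $|z|=r$ for which the inequality fails. *)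

theory Defs
  imports "HOL-Complex_Analysis.Complex_Analysis"
begin

definition wirt_z :: "(complex \<Rightarrow> complex) \<Rightarrow> complex \<Rightarrow> complex" where
  "wirt_z f z = (frechet_derivative f (at z) 1 - \<i> * frechet_derivative f (at z) \<i>) / 2"

definition wirt_zbar :: "(complex \<Rightarrow> complex) \<Rightarrow> complex \<Rightarrow> complex" where
  "wirt_zbar f z = (frechet_derivative f (at z) 1 + \<i> * frechet_derivative f (at z) \<i>) / 2"

definition Dop :: "(complex \<Rightarrow> complex) \<Rightarrow> complex \<Rightarrow> complex" where
  "Dop f = (\<lambda>z. z * wirt_z f z - cnj z * wirt_zbar f z)"

definition Dscr :: "(complex \<Rightarrow> complex) \<Rightarrow> complex \<Rightarrow> complex" where
  "Dscr f = (\<lambda>z. z * wirt_z f z + cnj z * wirt_zbar f z)"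

definition Bcls :: "nat \<Rightarrow> (complex \<Rightarrow> complex) set" where
  "Bcls n = {\<omega>. \<omega> holomorphic_on ball 0 1 \<and> (\<forall>z\<in>ball 0 1. norm (\<omega> z) \<le> 1) \<and>
              (\<forall>k<n. (deriv ^^ k) \<omega> 0 = 0) \<and> (deriv ^^ n) \<omega> 0 \<noteq> 0}"

definition stable_convex_S0H :: "(complex \<Rightarrow> complex) \<Rightarrow> (complex \<Rightarrow> complex) \<Rightarrow> bool" where
  "stable_convex_S0H h g \<longleftrightarrow>
     h holomorphic_on ball 0 1 \<and> g holomorphic_on ball 0 1 \<and>
     h 0 = 0 \<and> deriv h 0 = 1 \<and> g 0 = 0 \<and> deriv g 0 = 0 \<and>
     inj_on (\<lambda>z. h z + cnj (g z)) (ball 0 1) \<and>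
     (\<forall>z\<in>ball 0 1. norm (deriv g z) < norm (deriv h z)) \<and>
     (\<forall>\<mu>. norm \<mu> = 1 \<longrightarrow>
        inj_on (\<lambda>z. h z + \<mu> * cnj (g z)) (ball 0 1) \<and>
        convex ((\<lambda>z. h z + \<mu> * cnj (g z)) ` ball 0 1))"

definition tcoeff :: "(complex \<Rightarrow> complex) \<Rightarrow> nat \<Rightarrow> complex" where
  "tcoeff h n = (deriv ^^ n) h 0 / fact n"

definition F8 :: "nat \<Rightarrow> nat \<Rightarrow> nat \<Rightarrow> real \<Rightarrow> real" where
  "F8 m p N r = r ^ m * (1 + r ^ m) / (1 - r ^ m) ^ 3 + r ^ (p * N) / (1 - r ^ p) - 1 / 2"

definition r8 :: "nat \<Rightarrow> nat \<Rightarrow> nat \<Rightarrow> real" where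
  "r8 m p N = (THE r. 0 < r \<and> r < 1 \<and> F8 m p N r = 0)"

definition tail_sum :: "(complex \<Rightarrow> complex) \<Rightarrow> (complex \<Rightarrow> complex) \<Rightarrow> nat \<Rightarrow> complex \<Rightarrow> real" where
  "tail_sum h g N w = (\<Sum>k. (norm (tcoeff h (k + N)) + norm (tcoeff g (k + N))) * norm w ^ (k + N))"

definition bdist :: "(complex \<Rightarrow> complex) \<Rightarrow> real" where
  "bdist f = infdist (f 0) (frontier (f ` ball 0 1))"

end

theory Submission
  imports Defs
begin

text \<open>
  Both operators send \<open>f = h + cnj g\<close> to \<open>E h + cnj (E g)\<close> with \<open>E F = z (z F')'\<close>, that is, they
  multiply the \<open>n\<close>-th coefficients by \<open>n\<^sup>2\<close>. So everything reduces to \<open>|a\<^sub>n| + |b\<^sub>n| \<le> 1\<close> and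
  \<open>d(f(0), \<partial>f(D)) \<ge> 1/2\<close>. For the coefficients, a shear argument shows that each
  analytic function \<open>\<phi> = h + \<nu> g\<close> with \<open>|\<nu>| = 1\<close> is convex and univalent; averaging \<open>\<phi>\<close> over the
  \<open>n\<close>-th roots of unity gives \<open>a\<^sub>n + \<nu> b\<^sub>n\<close> as the leading coefficient of a function
  subordinate to \<open>\<phi>\<close>. For the distance, a half-plane omitted by the convex image \<open>f(D)\<close> gives an
  analytic function with nonnegative real part, whose derivative at 0 is controlled. The half-plane
  map \<open>z / (1 - z)\<close> with \<open>\<omega>\<^sub>m = z\<^sup>m\<close> and \<open>\<omega>\<^sub>p = z\<^sup>p\<close> is extremal.
\<close>

section \<open>Wirtinger derivatives and the second-order operators\<close>

text \<open>The form \<open>H + cnj G\<close> is assumed only on an open set, because iterating the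
  operators meets functions known in that form only there.\<close>

lemma wirtinger_holomorphic_add_cnj:
  assumes "open S" "z \<in> S" "H holomorphic_on S" "G holomorphic_on S"
    and f: "\<And>w. w \<in> S \<Longrightarrow> f w = H w + cnj (G w)"
  shows "wirt_z f z = deriv H z" "wirt_zbar f z = cnj (deriv G z)"
proof -
  have H: "(H has_derivative (\<lambda>t. deriv H z * t)) (at z)"
    using holomorphic_derivI[OF assms(3,1,2)] by (simp add: has_field_derivative_def)
  have G: "(G has_derivative (\<lambda>t. deriv G z * t)) (at z)"
    using holomorphic_derivI[OF assms(4,1,2)] by (simp add: has_field_derivative_def)
  have "((\<lambda>w. H w + cnj (G w)) has_derivative (\<lambda>t. deriv H z * t + cnj (deriv G z * t))) (at z)"
    by (intro has_derivative_add H has_derivative_cnj G)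
  then have "(f has_derivative (\<lambda>t. deriv H z * t + cnj (deriv G z * t))) (at z)"
    by (rule has_derivative_transform_within_open[OF _ assms(1,2)]) (simp add: f)
  then have "frechet_derivative f (at z) = (\<lambda>t. deriv H z * t + cnj (deriv G z * t))"
    by (rule frechet_derivative_at[symmetric])
  then show "wirt_z f z = deriv H z" "wirt_zbar f z = cnj (deriv G z)"
    by (simp_all add: wirt_z_def wirt_zbar_def algebra_simps)
qed

text \<open>One application leaves the form \<open>H + cnj G\<close> intact: \<open>Dop\<close> and
  \<open>Dscr\<close> differ only in the sign of the new \<open>G\<close>, and for
  \<open>Dop\<close> the second application cancels that sign.\<close>

lemma second_order_operators:
  assumes "open S" "z \<in> S" "H holomorphic_on S" "G holomorphic_on S"
    and f: "\<And>w. w \<in> S \<Longrightarrow> f w = H w + cnj (G w)"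
  defines "E \<equiv> (\<lambda>F. z * deriv F z + z\<^sup>2 * deriv (deriv F) z)"
  shows "Dop (Dop f) z = E H + cnj (E G)" "Dscr (Dscr f) z = E H + cnj (E G)"
proof -
  have euler: "deriv (\<lambda>w. w * deriv F w) z = deriv F z + z * deriv (deriv F) z"
    if "F holomorphic_on S" for F
  proof -
    have "(deriv F has_field_derivative deriv (deriv F) z) (at z)"
      by (rule holomorphic_derivI[OF holomorphic_deriv[OF that \<open>open S\<close>] assms(1,2)])
    from DERIV_mult[OF DERIV_ident this] show ?thesis
      by (intro DERIV_imp_deriv) (simp add: algebra_simps)
  qed
  have hol: "(\<lambda>w. w * deriv F w) holomorphic_on S" if "F holomorphic_on S" for F
    by (intro holomorphic_intros that \<open>open S\<close>)
  have "Dop f w = w * deriv H w + cnj (- (w * deriv G w))"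
       "Dscr f w = w * deriv H w + cnj (w * deriv G w)" if "w \<in> S" for w
    using wirtinger_holomorphic_add_cnj[OF \<open>open S\<close> that assms(3,4) f]
    by (simp_all add: Dop_def Dscr_def)
  note D = wirtinger_holomorphic_add_cnj[OF assms(1,2) hol[OF assms(3)]
      holomorphic_on_minus[OF hol[OF assms(4)]] this(1)]
    and Ds = wirtinger_holomorphic_add_cnj[OF assms(1,2) hol[OF assms(3)] hol[OF assms(4)] this(2)]
  have neg: "deriv (\<lambda>w. - (w * deriv G w)) z = - deriv (\<lambda>w. w * deriv G w) z"
    using holomorphic_on_imp_differentiable_at[OF hol[OF assms(4)] assms(1,2)]
    by (rule deriv_minus)
  show "Dop (Dop f) z = E H + cnj (E G)"
    by (subst Dop_def) (simp add: D neg euler assms(3,4) E_def algebra_simps power2_eq_square)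
  show "Dscr (Dscr f) z = E H + cnj (E G)"
    by (subst Dscr_def) (simp add: Ds euler assms(3,4) E_def algebra_simps power2_eq_square)
qed

section \<open>Power series in the disc\<close>

lemma tcoeff_sums:
  assumes "f holomorphic_on ball 0 1" "norm w < 1"
  shows "(\<lambda>n. tcoeff f n * w ^ n) sums f w"
  using holomorphic_power_series[OF assms(1), of w] assms(2) by (simp add: tcoeff_def)

text \<open>The two derivative terms contribute the factors \<open>n\<close> and
  \<open>n * (n - 1)\<close>, which add up to \<open>n ^ 2\<close>.\<close>

lemma second_order_sums:
  assumes f: "f holomorphic_on ball 0 1" and w: "norm w < 1"
  shows "(\<lambda>n. of_nat (n ^ 2) * tcoeff f n * w ^ n) sums (w * deriv f w + w\<^sup>2 * deriv (deriv f) w)"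
proof -
  have f1: "deriv f holomorphic_on ball 0 1" by (intro holomorphic_intros f) auto
  have f2: "deriv (deriv f) holomorphic_on ball 0 1" by (intro holomorphic_intros f1) auto
  have "(\<lambda>n. w * (tcoeff (deriv f) n * w ^ n)) sums (w * deriv f w)"
    by (intro sums_mult tcoeff_sums f1 w)
  then have "(\<lambda>n. of_nat (n + 1) * tcoeff f (n + 1) * w ^ (n + 1)) sums (w * deriv f w)"
  proof (rule back_subst[where P = "\<lambda>s. s sums _"], intro ext)
    fix n
    have "(deriv ^^ n) (deriv f) 0 = (deriv ^^ (n + 1)) f 0"
      by (simp add: funpow_swap1)
    moreover have "fact (n + 1) = of_nat (n + 1) * (fact n :: complex)"
      by simp
    moreover have "of_nat (n + 1) \<noteq> (0 :: complex)"
      by (simp only: of_nat_eq_0_iff)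
    ultimately show "w * (tcoeff (deriv f) n * w ^ n) =
        of_nat (n + 1) * tcoeff f (n + 1) * w ^ (n + 1)"
      by (simp add: tcoeff_def del: of_nat_mult of_nat_add of_nat_Suc fact_Suc)
  qed
  then have 1: "(\<lambda>n. of_nat n * tcoeff f n * w ^ n) sums (w * deriv f w)"
    by (subst (asm) sums_iff_shift) simp
  have "(\<lambda>n. w\<^sup>2 * (tcoeff (deriv (deriv f)) n * w ^ n)) sums (w\<^sup>2 * deriv (deriv f) w)"
    by (intro sums_mult tcoeff_sums f2 w)
  then have "(\<lambda>n. of_nat ((n + 2) * (n + 1)) * tcoeff f (n + 2) * w ^ (n + 2))
      sums (w\<^sup>2 * deriv (deriv f) w)"
  proof (rule back_subst[where P = "\<lambda>s. s sums _"], intro ext)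
    fix n
    have "(deriv ^^ n) (deriv (deriv f)) 0 = (deriv ^^ (n + 2)) f 0"
      by (simp add: funpow_swap1)
    moreover have "fact (n + 2) = of_nat ((n + 2) * (n + 1)) * (fact n :: complex)"
      by (simp add: algebra_simps)
    moreover have "of_nat ((n + 2) * (n + 1)) \<noteq> (0 :: complex)"
      by (simp only: of_nat_eq_0_iff) simp
    ultimately show "w\<^sup>2 * (tcoeff (deriv (deriv f)) n * w ^ n) =
        of_nat ((n + 2) * (n + 1)) * tcoeff f (n + 2) * w ^ (n + 2)"
      by (simp add: tcoeff_def power_add power2_eq_square del: of_nat_mult of_nat_add fact_Suc)
  qed
  \<comment> \<open>The factor \<open>n * (n - 1)\<close> vanishes at \<open>n = 0\<close> and
    \<open>n = 1\<close>, so the shift by 2 drops nothing.\<close>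
  then have "(\<lambda>n. of_nat (n * (n - 1)) * tcoeff f n * w ^ n) sums (w\<^sup>2 * deriv (deriv f) w)"
    using sums_iff_shift[of "\<lambda>n. of_nat (n * (n - 1)) * tcoeff f n * w ^ n" 2]
    by (simp add: numeral_2_eq_2)
  from sums_add[OF 1 this] show ?thesis
  proof (rule back_subst[where P = "\<lambda>s. s sums _"], intro ext)
    fix n :: nat
    have "of_nat n + of_nat (n * (n - 1)) = (of_nat (n ^ 2) :: complex)"
      by (cases n) (simp_all add: power2_eq_square algebra_simps)
    then show "of_nat n * tcoeff f n * w ^ n + of_nat (n * (n - 1)) * tcoeff f n * w ^ n =
        of_nat (n ^ 2) * tcoeff f n * w ^ n"
      by (metis distrib_right)
  qed
qed

text \<open>Away from 0 the quotient \<open>f w / w ^ n\<close> is the sum of the shifted series,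
  and \<open>a n\<close> is the value of that series at 0.\<close>

lemma factor_power:
  fixes a :: "nat \<Rightarrow> complex"
  assumes s: "\<And>w. norm w < 1 \<Longrightarrow> (\<lambda>k. a k * w ^ k) sums f w"
    and a: "\<And>k. k < n \<Longrightarrow> a k = 0"
  obtains q where "q holomorphic_on ball 0 1" "q 0 = a n" "\<And>w. norm w < 1 \<Longrightarrow> f w = w ^ n * q w"
proof
  define q where "q = (\<lambda>w. if w = 0 then a n else f w / w ^ n)"
  have "(\<lambda>k. a (k + n) * (w - 0) ^ k) sums q w" if "w \<in> ball 0 1" for w
  proof (cases "w = 0")
    case False
    have "(\<lambda>k. a (k + n) * w ^ (k + n)) sums f w"
      using s[of w] that a by (subst sums_iff_shift) simp
    from sums_divide[OF this, of "w ^ n"] False show ?thesis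
      by (simp add: q_def power_add)
  qed (simp add: q_def)
  then show "q holomorphic_on ball 0 1" by (rule power_series_holomorphic)
  show "q 0 = a n" by (simp add: q_def)
  show "f w = w ^ n * q w" if "norm w < 1" for w
  proof (cases "w = 0")
    case True
    have "f 0 = a 0" using s[of 0] by simp
    with True a show ?thesis by (cases n) (simp_all add: q_def)
  qed (simp add: q_def)
qed

section \<open>Schwarz lemma and the classes \<open>Bcls n\<close>\<close>

text \<open>The Schwarz lemma for a zero of order \<open>n\<close>: the maximum principle on the
  circle of radius \<open>\<rho>\<close> gives the bound \<open>1 / \<rho> ^ n\<close>, and then
  \<open>\<rho>\<close> tends to 1.\<close>

lemma norm_le_1_if_power_mult_le_1:
  assumes Q: "Q holomorphic_on ball 0 1"
    and b: "\<And>z. norm z < 1 \<Longrightarrow> norm (z ^ n * Q z) \<le> 1" and z: "norm z < 1"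
  shows "norm (Q z) \<le> 1"
proof -
  have bound: "norm (Q z) * \<rho> ^ n \<le> 1" if \<rho>: "norm z < \<rho>" "\<rho> < 1" for \<rho>
  proof -
    have \<rho>0: "\<rho> > 0" using \<rho> norm_ge_zero[of z] by linarith
    have "norm (Q z) \<le> 1 / \<rho> ^ n"
    proof (rule maximum_modulus_frontier[where f = Q and \<xi> = z and S = "cball 0 \<rho>"])
      show "Q holomorphic_on interior (cball 0 \<rho>)"
        using \<rho> by (intro holomorphic_on_subset[OF Q]) auto
      show "continuous_on (closure (cball 0 \<rho>)) Q"
        using \<rho> by (intro continuous_on_subset[OF holomorphic_on_imp_continuous_on[OF Q]]) auto
      show "norm (Q \<zeta>) \<le> 1 / \<rho> ^ n" if "\<zeta> \<in> frontier (cball 0 \<rho>)" for \<zeta>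
        using that b[of \<zeta>] \<rho> \<rho>0 by (simp add: norm_mult norm_power field_simps)
    qed (use \<rho> in auto)
    with \<rho>0 show ?thesis by (simp add: field_simps)
  qed
  have "((\<lambda>\<rho>. norm (Q z) * \<rho> ^ n) \<longlongrightarrow> norm (Q z) * 1 ^ n) (at_left 1)"
    by (intro tendsto_intros)
  moreover have "\<forall>\<^sub>F \<rho> in at_left 1. norm (Q z) * \<rho> ^ n \<le> 1"
    using eventually_at_left_real[OF z] by eventually_elim (use bound in auto)
  ultimately show ?thesis
    using tendsto_upperbound trivial_limit_at_left_real by fastforce
qed

lemma Bcls_bound:
  assumes "\<omega> \<in> Bcls n" "norm z < 1"
  shows "norm (\<omega> z) \<le> norm z ^ n"
proof -
  have hol: "\<omega> holomorphic_on ball 0 1" and b: "\<And>z. norm z < 1 \<Longrightarrow> norm (\<omega> z) \<le> 1"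
    and d: "\<And>k. k < n \<Longrightarrow> tcoeff \<omega> k = 0"
    using assms(1) by (auto simp: Bcls_def tcoeff_def)
  obtain q where q: "q holomorphic_on ball 0 1" "\<And>w. norm w < 1 \<Longrightarrow> \<omega> w = w ^ n * q w"
    using factor_power[OF tcoeff_sums[OF hol] d] by metis
  have "norm (q z) \<le> 1"
    by (rule norm_le_1_if_power_mult_le_1[of _ n]) (use q b assms(2) in fastforce)+
  with q(2)[OF assms(2)] show ?thesis
    by (simp add: norm_mult norm_power mult_left_le)
qed

lemma power_in_Bcls: "(\<lambda>z. z ^ n) \<in> Bcls n"
proof -
  have "(deriv ^^ k) (\<lambda>z. z ^ n) (0 :: complex) = 0" if "k < n" for k
    using higher_deriv_power[of k "0 :: complex" n 0] that by simp
  moreover have "(deriv ^^ n) (\<lambda>z. z ^ n) (0 :: complex) \<noteq> 0"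
    using higher_deriv_power[of n "0 :: complex" n 0] by (simp add: pochhammer_fact[symmetric])
  ultimately show ?thesis
    by (auto simp: Bcls_def norm_power intro!: holomorphic_intros power_le_one)
qed

section \<open>Estimates for convex univalent functions and for nonnegative real part\<close>

text \<open>The summands are the powers \<open>c ^ j\<close> of a single number with
  \<open>c ^ n = 1\<close>, so the geometric sum vanishes unless \<open>c = 1\<close>.\<close>

lemma sum_root_of_unity_powers:
  assumes "n \<ge> 1"
  shows "(\<Sum>j<n. exp (2 * of_real pi * \<i> * of_nat j / of_nat n) ^ k) =
    (if n dvd k then of_nat n else 0)"
proof -
  define c where "c = exp (2 * of_real pi * \<i> * of_nat k / of_nat n)"
  have "exp (2 * of_real pi * \<i> * of_nat j / of_nat n) ^ k = c ^ j" for j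
    by (simp add: c_def exp_of_nat_mult[symmetric] mult_ac)
  moreover have "c ^ n = 1"
    using assms exp_of_nat_mult[of n "2 * of_real pi * \<i> * of_nat k / of_nat n"]
      exp_integer_2pi[of "of_nat k"] by (simp add: c_def mult_ac)
  moreover have "c = 1 \<longleftrightarrow> n dvd k"
    unfolding c_def by (rule complex_root_unity_eq_1[OF assms])
  ultimately show ?thesis
    by (auto simp: geometric_sum)
qed

text \<open>With \<open>\<psi>\<close> the average of \<open>\<phi>\<close> over the \<open>n\<close>-th roots of unity and \<open>\<gamma>\<close> the inverse of \<open>\<phi>\<close>, the
  self-map \<open>\<gamma> \<circ> \<psi>\<close> of the disc has leading term \<open>tcoeff \<phi> n z\<^sup>n\<close>.\<close>

lemma convex_univalent_coefficient_bound:
  assumes hol: "\<phi> holomorphic_on ball 0 1" and inj: "inj_on \<phi> (ball 0 1)"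
    and cvx: "convex (\<phi> ` ball 0 1)"
    and \<phi>0: "\<phi> 0 = 0" and \<phi>1: "deriv \<phi> 0 = 1" and n: "n \<ge> 1"
  shows "norm (tcoeff \<phi> n) \<le> 1"
proof -
  define \<zeta> where "\<zeta> = (\<lambda>j::nat. exp (2 * of_real pi * \<i> * of_nat j / of_nat n))"
  have norm_\<zeta>: "norm (\<zeta> j) = 1" for j by (simp add: \<zeta>_def norm_exp_eq_Re)
  define \<psi> where "\<psi> = (\<lambda>z. \<Sum>j<n. (1 / n) *\<^sub>R \<phi> (\<zeta> j * z))"
  define a where "a = (\<lambda>k. if n dvd k then tcoeff \<phi> k else 0)"
  \<comment> \<open>\<open>\<psi> z\<close> is a convex combination of values of
    \<open>\<phi>\<close> at rotated points; this is where convexity of the image enters.\<close>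
  have \<psi>_in: "\<psi> z \<in> \<phi> ` ball 0 1" if "norm z < 1" for z
    unfolding \<psi>_def
    using n that by (intro convex_sum cvx) (auto simp: norm_mult norm_\<zeta>)
  have "(\<lambda>k. a k * w ^ k) sums \<psi> w" if "norm w < 1" for w
  proof -
    have "(\<lambda>k. \<Sum>j<n. (1 / n) *\<^sub>R (tcoeff \<phi> k * (\<zeta> j * w) ^ k)) sums \<psi> w"
      unfolding \<psi>_def
      by (intro sums_sum sums_scaleR_right tcoeff_sums hol) (simp add: norm_mult norm_\<zeta> that)
    moreover have "(\<Sum>j<n. (1 / n) *\<^sub>R (tcoeff \<phi> k * (\<zeta> j * w) ^ k)) = a k * w ^ k" for k
    proof -
      have "(\<Sum>j<n. (1 / n) *\<^sub>R (tcoeff \<phi> k * (\<zeta> j * w) ^ k)) =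
          (1 / n) *\<^sub>R (tcoeff \<phi> k * w ^ k * (\<Sum>j<n. \<zeta> j ^ k))"
        by (simp add: sum_distrib_left scaleR_sum_right power_mult_distrib mult_ac)
      also have "\<dots> = a k * w ^ k"
        using n by (simp add: \<zeta>_def sum_root_of_unity_powers a_def scaleR_conv_of_real)
      finally show ?thesis .
    qed
    ultimately show ?thesis by simp
  qed
  moreover have "a k = 0" if "k < n" for k
    using that \<phi>0 by (auto simp: a_def tcoeff_def dest: nat_dvd_not_less)
  ultimately obtain q where q: "q holomorphic_on ball 0 1" "q 0 = a n"
      "\<And>w. norm w < 1 \<Longrightarrow> \<psi> w = w ^ n * q w"
    using factor_power by blast
  obtain \<gamma> where \<gamma>: "\<gamma> holomorphic_on \<phi> ` ball 0 1"
      "\<And>z. z \<in> ball 0 1 \<Longrightarrow> deriv \<phi> z * deriv \<gamma> (\<phi> z) = 1"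
      "\<And>z. z \<in> ball 0 1 \<Longrightarrow> \<gamma> (\<phi> z) = z"
    using holomorphic_has_inverse[OF hol _ inj] by auto
  \<comment> \<open>The difference quotient of \<open>\<gamma>\<close> at 0 gives
    \<open>\<gamma> (\<psi> z) = z ^ n * (q z * \<kappa> (\<psi> z))\<close>. The left side is
    bounded by 1, so the Schwarz lemma bounds the last factor; at 0 that factor is
    \<open>tcoeff \<phi> n\<close>.\<close>
  define \<kappa> where "\<kappa> = (\<lambda>w. if w = 0 then deriv \<gamma> 0 else (\<gamma> w - \<gamma> 0) / (w - 0))"
  have "open (\<phi> ` ball 0 1)"
    by (rule open_mapping_thm3[OF hol _ inj]) simp
  then have \<kappa>: "\<kappa> holomorphic_on \<phi> ` ball 0 1"
    unfolding \<kappa>_def by (intro pole_lemma_open \<gamma>(1))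
  have \<gamma>0: "\<gamma> 0 = 0" using \<gamma>(3)[of 0] \<phi>0 by simp
  have \<gamma>_eq: "\<gamma> w = w * \<kappa> w" for w by (simp add: \<kappa>_def \<gamma>0)
  have \<psi>_hol: "\<psi> holomorphic_on ball 0 1"
  proof (rule holomorphic_transform[where f = "\<lambda>w. w ^ n * q w"])
    show "(\<lambda>w. w ^ n * q w) holomorphic_on ball 0 1" by (intro holomorphic_intros q(1))
  qed (simp add: q(3))
  have \<psi>0: "\<psi> 0 = 0" using n by (simp add: \<psi>_def \<phi>0)
  have "norm (q 0 * \<kappa> (\<psi> 0)) \<le> 1"
  proof (rule norm_le_1_if_power_mult_le_1[where n = n and z = 0 and Q = "\<lambda>z. q z * \<kappa> (\<psi> z)"])
    have "(\<lambda>z. \<kappa> (\<psi> z)) holomorphic_on ball 0 1"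
      using holomorphic_on_compose_gen[OF \<psi>_hol \<kappa> image_subsetI] \<psi>_in by (simp add: o_def)
    then show "(\<lambda>z. q z * \<kappa> (\<psi> z)) holomorphic_on ball 0 1"
      by (intro holomorphic_intros q(1))
    show "norm (z ^ n * (q z * \<kappa> (\<psi> z))) \<le> 1" if z: "norm z < 1" for z
    proof -
      obtain z' where "norm z' < 1" "\<psi> z = \<phi> z'" using \<psi>_in[OF z] by auto
      then have "norm (\<gamma> (\<psi> z)) < 1" using \<gamma>(3)[of z'] by simp
      then show ?thesis
        using z by (simp add: \<gamma>_eq q(3) mult.assoc)
    qed
  qed simp
  moreover have "\<kappa> 0 = 1" using \<gamma>(2)[of 0] \<phi>0 \<phi>1 by (simp add: \<kappa>_def)
  ultimately show ?thesis using q(2) \<psi>0 by (simp add: a_def)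
qed

text \<open>The Cayley transform \<open>S = (P - c) / (P + c)\<close> maps the disc into the closed
  unit disc and fixes 0. Its derivative there is \<open>deriv P 0 / (2 * c)\<close>, so the Schwarz
  lemma applies.\<close>

lemma deriv_at_0_le_if_Re_nonneg:
  assumes P: "P holomorphic_on ball 0 1" and re: "\<And>z. norm z < 1 \<Longrightarrow> Re (P z) \<ge> 0"
    and P0: "P 0 = complex_of_real c" and c: "c > 0"
  shows "norm (deriv P 0) \<le> 2 * c"
proof -
  have nz: "P z + c \<noteq> 0" if "norm z < 1" for z
    using re[OF that] c by (auto simp: complex_eq_iff)
  define S where "S = (\<lambda>z. (P z - c) / (P z + c))"
  have S: "S holomorphic_on ball 0 1"
    unfolding S_def using nz by (intro holomorphic_intros P) auto
  define k where "k = (\<lambda>z. if z = 0 then deriv S 0 else (S z - S 0) / (z - 0))"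
  have k: "k holomorphic_on ball 0 1"
    unfolding k_def by (intro pole_lemma_open S) auto
  have S0: "S 0 = 0" by (simp add: S_def P0)
  have bound: "norm (S z) \<le> 1" if "norm z < 1" for z
  proof -
    have "(norm (P z - c))\<^sup>2 \<le> (norm (P z + c))\<^sup>2"
      using re[OF that] c by (simp add: cmod_power2) (simp add: power2_eq_square algebra_simps)
    then have "norm (P z - c) \<le> norm (P z + c)" by (rule power2_le_imp_le) simp
    with nz[OF that] show ?thesis by (simp add: S_def norm_divide divide_le_eq_1)
  qed
  have "norm (k 0) \<le> 1"
  proof (rule norm_le_1_if_power_mult_le_1[where n = 1, OF k])
    show "norm (z ^ 1 * k z) \<le> 1" if "norm z < 1" for z
      using bound[OF that] by (simp add: k_def S0)
  qed simp
  moreover have "(S has_field_derivative deriv P 0 / (2 * c)) (at 0)"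
  proof -
    have "(P has_field_derivative deriv P 0) (at 0)"
      by (rule holomorphic_derivI[OF P]) auto
    then show ?thesis
      unfolding S_def using c P0 by (auto intro!: derivative_eq_intros simp: field_simps)
  qed
  ultimately have "norm (deriv P 0 / (2 * c)) \<le> 1" by (simp add: k_def DERIV_imp_deriv)
  with c show ?thesis by (simp add: norm_divide norm_mult divide_le_eq)
qed

text \<open>Converts bounds on \<open>a + \<nu> * b\<close> for all unit \<open>\<nu>\<close> into a
  bound on the sum of the moduli: \<open>\<nu>\<close> rotates the direction of \<open>b\<close> to
  that of \<open>a\<close>.\<close>

lemma aligning_unit:
  fixes a b :: complex
  obtains \<nu> where "norm \<nu> = 1" "norm (a + \<nu> * b) = norm a + norm b"
proof
  let ?u = "cis (Arg a)" and ?v = "cis (Arg b)"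
  show "norm (?u * cnj ?v) = 1" by (simp add: norm_mult)
  have polar: "z = cis (Arg z) * norm z" for z
    using rcis_cmod_Arg[of z] by (simp add: rcis_def mult.commute)
  have "cnj ?v * b = cnj ?v * (?v * norm b)" by (simp flip: polar)
  also have "\<dots> = norm b" by (simp add: cis_cnj cis_mult flip: mult.assoc)
  finally have "a + ?u * cnj ?v * b = ?u * norm a + ?u * norm b"
    using polar[of a] by (simp add: mult.assoc)
  then have "a + ?u * cnj ?v * b = ?u * of_real (norm a + norm b)"
    by (simp add: distrib_left)
  then show "norm (a + ?u * cnj ?v * b) = norm a + norm b"
    by (simp only: norm_mult norm_of_real) simp
qed

section \<open>From stable convexity to convexity of \<open>h + \<nu> g\<close>\<close>

locale stable_convex =
  fixes h g :: "complex \<Rightarrow> complex"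
  assumes sc: "stable_convex_S0H h g"
begin

lemma hol: "h holomorphic_on ball 0 1" "g holomorphic_on ball 0 1"
  and normalized: "h 0 = 0" "deriv h 0 = 1" "g 0 = 0" "deriv g 0 = 0"
  and sense_preserving: "norm z < 1 \<Longrightarrow> norm (deriv g z) < norm (deriv h z)"
  and stable_inj: "norm \<mu> = 1 \<Longrightarrow> inj_on (\<lambda>z. h z + \<mu> * cnj (g z)) (ball 0 1)"
  and stable_convex: "norm \<mu> = 1 \<Longrightarrow> convex ((\<lambda>z. h z + \<mu> * cnj (g z)) ` ball 0 1)"
  using sc by (auto simp: stable_convex_S0H_def)

lemma field_differentiable:
  assumes "norm z < 1"
  shows "h field_differentiable at z" "g field_differentiable at z"
  using assms hol by (auto intro: holomorphic_on_imp_differentiable_at)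

text \<open>If the moduli agreed, some unit \<open>\<mu>\<close> would give
  \<open>h + \<mu> cnj g\<close> the same value at \<open>x\<close> and \<open>y\<close>, against
  stable univalence.\<close>

lemma increments_norm_neq:
  assumes "norm x < 1" "norm y < 1" "x \<noteq> y"
  shows "norm (h x - h y) \<noteq> norm (g x - g y)"
proof
  assume eq: "norm (h x - h y) = norm (g x - g y)"
  \<comment> \<open>If \<open>g x = g y\<close>, equal moduli force \<open>h x = h y\<close> as
    well, and \<open>\<mu> = 1\<close> already produces the collision.\<close>
  define \<mu> where "\<mu> = (if g x = g y then 1 else - (h x - h y) / cnj (g x - g y))"
  have "norm \<mu> = 1"
    using eq by (auto simp: \<mu>_def norm_divide norm_minus_commute simp flip: complex_cnj_diff)
  moreover have "h x - h y = - \<mu> * cnj (g x - g y)"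
    using eq by (auto simp: \<mu>_def)
  then have "h x + \<mu> * cnj (g x) = h y + \<mu> * cnj (g y)"
    by (simp add: algebra_simps)
  ultimately have "x = y"
    using stable_inj[of \<mu>] assms(1,2) by (auto simp: inj_on_def)
  with assms(3) show False ..
qed

text \<open>The two increments never have equal modulus, and close to the diagonal sense preservation
  decides which one is larger.\<close>

lemma increments_norm_less:
  assumes x: "norm x < 1" and y: "norm y < 1" and "x \<noteq> y"
  shows "norm (g x - g y) < norm (h x - h y)"
proof -
  define \<gamma> where "\<gamma> = (\<lambda>t::real. y + t *\<^sub>R (x - y))"
  have \<gamma>: "norm (\<gamma> t) < 1" if "0 \<le> t" "t \<le> 1" for t
  proof -
    have "\<gamma> t \<in> closed_segment y x"
      using that by (auto simp: \<gamma>_def in_segment algebra_simps)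
    then show ?thesis
      using x y closed_segment_subset[of y "ball 0 1" x] by auto
  qed
  \<comment> \<open>\<open>q\<close> is continuous, vanishes at 0 and has no zero in
    \<open>(0, 1]\<close>, so one positive value there makes \<open>q 1\<close> positive.\<close>
  define q where "q = (\<lambda>t. norm (h (\<gamma> t) - h y) - norm (g (\<gamma> t) - g y))"
  have cont: "continuous_on {0..1} (\<lambda>t. F (\<gamma> t))" if "F holomorphic_on ball 0 1" for F :: "complex \<Rightarrow> complex"
    by (rule continuous_on_compose2[OF holomorphic_on_imp_continuous_on[OF that]])
      (auto simp: \<gamma>_def[symmetric] \<gamma> intro!: continuous_intros, auto simp: \<gamma>_def intro!: continuous_intros)
  have q_cont: "continuous_on {0..1} q"
    unfolding q_def by (intro continuous_intros cont hol)
  have q_nz: "q t \<noteq> 0" if "0 < t" "t \<le> 1" for t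
    using increments_norm_neq[of "\<gamma> t" y] \<gamma>[of t] that \<open>x \<noteq> y\<close> y by (auto simp: q_def \<gamma>_def)
  have "\<exists>t. 0 < t \<and> t \<le> 1 \<and> q t > 0"
  proof -
    \<comment> \<open>Dividing both increments by \<open>\<gamma> t - y\<close> keeps the sign of
      \<open>q t\<close>; the limit at 0 is \<open>norm (deriv h y) - norm (deriv g y)\<close>,
      which is positive.\<close>
    have lim: "((\<lambda>w. norm ((F w - F y) / (w - y))) \<longlongrightarrow> norm (deriv F y)) (at y)"
      if "F field_differentiable at y" for F
      using that by (intro tendsto_norm) (simp add: DERIV_deriv_iff_field_differentiable
          flip: has_field_derivative_iff)
    have "((\<lambda>w. norm ((h w - h y) / (w - y)) - norm ((g w - g y) / (w - y)))
        \<longlongrightarrow> norm (deriv h y) - norm (deriv g y)) (at y)"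
      by (intro tendsto_diff lim field_differentiable y)
    moreover have "filterlim \<gamma> (at y) (at_right 0)"
    proof (rule filterlim_atI)
      have "(\<gamma> \<longlongrightarrow> y + 0 *\<^sub>R (x - y)) (at_right 0)"
        unfolding \<gamma>_def by (intro tendsto_intros)
      then show "(\<gamma> \<longlongrightarrow> y) (at_right 0)" by simp
      show "\<forall>\<^sub>F t in at_right 0. \<gamma> t \<noteq> y"
        using eventually_at_right_less[of 0] by eventually_elim (use \<open>x \<noteq> y\<close> in \<open>auto simp: \<gamma>_def\<close>)
    qed
    ultimately have "((\<lambda>t. norm ((h (\<gamma> t) - h y) / (\<gamma> t - y)) - norm ((g (\<gamma> t) - g y) / (\<gamma> t - y)))
        \<longlongrightarrow> norm (deriv h y) - norm (deriv g y)) (at_right 0)"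
      by (rule filterlim_compose)
    then have "\<forall>\<^sub>F t in at_right 0.
        0 < norm ((h (\<gamma> t) - h y) / (\<gamma> t - y)) - norm ((g (\<gamma> t) - g y) / (\<gamma> t - y))"
      by (rule order_tendstoD) (use sense_preserving[OF y] in simp)
    moreover have "\<forall>\<^sub>F t in at_right (0::real). 0 < t \<and> t < 1"
      using eventually_at_right_real[of 0 1] by auto
    ultimately have "\<forall>\<^sub>F t in at_right 0. 0 < t \<and> t \<le> 1 \<and> q t > 0"
    proof eventually_elim
      case (elim t)
      then have "norm (\<gamma> t - y) > 0" using \<open>x \<noteq> y\<close> by (simp add: \<gamma>_def)
      with elim show ?case
        by (simp add: q_def norm_divide zero_less_divide_iff flip: diff_divide_distrib)
    qed
    then show ?thesis
      using eventually_happens trivial_limit_at_right_real by blast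
  qed
  then obtain t where t: "0 < t" "t \<le> 1" "q t > 0" by blast
  have "q 1 > 0"
  proof (rule ccontr)
    assume "\<not> q 1 > 0"
    then obtain s where "t \<le> s" "s \<le> 1" "q s = 0"
      using IVT2'[of q 1 0 t] t continuous_on_subset[OF q_cont, of "{t..1}"] by auto
    with q_nz[of s] t show False by auto
  qed
  then show ?thesis by (simp add: q_def \<gamma>_def)
qed

text \<open>Conjugating \<open>g\<close> does not affect the moduli of its increments, so a
  collision is excluded as in the harmonic case.\<close>

lemma analytic_inj:
  assumes "norm \<nu> = 1"
  shows "inj_on (\<lambda>z. h z + \<nu> * g z) (ball 0 1)"
proof (rule inj_onI, rule ccontr)
  fix x y assume xy: "x \<in> ball 0 1" "y \<in> ball 0 1" "x \<noteq> y"
    and "h x + \<nu> * g x = h y + \<nu> * g y"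
  then have "h x - h y = - \<nu> * (g x - g y)"
    by (simp add: algebra_simps)
  then have "norm (h x - h y) = norm (g x - g y)"
    using assms by (simp add: norm_mult)
  with increments_norm_neq xy show False by auto
qed

text \<open>The shear argument of Clunie and Sheil-Small: for a unit vector \<open>u\<close> the functions
  \<open>h + \<nu> g\<close> and \<open>h + \<mu> cnj g\<close> with \<open>\<mu> = - u\<^sup>2 cnj \<nu>\<close> differ by a real multiple of \<open>u\<close>, so both have
  the same component orthogonal to \<open>u\<close>.\<close>

lemma analytic_convex:
  assumes \<nu>: "norm \<nu> = 1"
  shows "convex ((\<lambda>z. h z + \<nu> * g z) ` ball 0 1)"
proof -
  define \<phi> where "\<phi> = (\<lambda>z. h z + \<nu> * g z)"
  have \<phi>_cont: "continuous_on (ball 0 1) \<phi>"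
    unfolding \<phi>_def by (intro continuous_intros holomorphic_on_imp_continuous_on hol)
  have "closed_segment (\<phi> a) (\<phi> b) \<subseteq> \<phi> ` ball 0 1" if ab: "a \<in> ball 0 1" "b \<in> ball 0 1" for a b
  proof (cases "\<phi> a = \<phi> b")
    case True
    with ab show ?thesis by auto
  next
    case False
    \<comment> \<open>With \<open>u\<close> the direction of the segment,
      \<open>Re (cnj u * w)\<close> and \<open>Im (cnj u * w)\<close> are the components of
      \<open>w\<close> along and across it.\<close>
    define u where "u = sgn (\<phi> b - \<phi> a)"
    have u: "norm u = 1" using False by (simp add: u_def norm_sgn)
    then have uu: "cnj u * u = 1" using complex_norm_square[of u] by (simp add: mult.commute)
    have ba: "\<phi> b - \<phi> a = norm (\<phi> b - \<phi> a) * u"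
      using False by (simp add: u_def sgn_eq)
    define \<mu> where "\<mu> = - (u\<^sup>2 * cnj \<nu>)"
    have \<mu>: "norm \<mu> = 1" using u \<nu> by (simp add: \<mu>_def norm_mult norm_power)
    define f where "f = (\<lambda>z. h z + \<mu> * cnj (g z))"
    have Im_eq: "Im (cnj u * f z) = Im (cnj u * \<phi> z)" for z
    proof -
      have "cnj u * \<phi> z - cnj u * f z = cnj u * \<nu> * g z + (cnj u * u) * u * cnj \<nu> * cnj (g z)"
        by (simp add: \<phi>_def f_def \<mu>_def algebra_simps power2_eq_square)
      also have "\<dots> = cnj u * \<nu> * g z + cnj (cnj u * \<nu> * g z)"
        by (simp add: uu)
      finally have "Im (cnj u * \<phi> z - cnj u * f z) = 0"
        by (simp only: complex_add_cnj) simp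
      then show ?thesis by simp
    qed
    have f_cont: "continuous_on (ball 0 1) f"
      unfolding f_def by (intro continuous_intros holomorphic_on_imp_continuous_on hol)
    obtain k where "homeomorphism (ball 0 1) (f ` ball 0 1) f k"
      using invariance_of_domain_homeomorphism[OF _ f_cont] stable_inj[OF \<mu>] by (auto simp: f_def)
    then have k_cont: "continuous_on (f ` ball 0 1) k"
      and k: "\<And>z. z \<in> ball 0 1 \<Longrightarrow> k (f z) = z"
      by (auto simp: homeomorphism_def)
    let ?\<sigma> = "closed_segment (f a) (f b)"
    have \<sigma>: "?\<sigma> \<subseteq> f ` ball 0 1"
      using stable_convex[OF \<mu>] ab unfolding f_def by (intro closed_segment_subset) auto
    \<comment> \<open>\<open>\<phi> a\<close> and \<open>\<phi> b\<close> have the same component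
      across \<open>u\<close>, hence so do \<open>f a\<close> and \<open>f b\<close>, and the whole
      segment between these stays at that height.\<close>
    have Im_\<sigma>: "Im (cnj u * s) = Im (cnj u * \<phi> a)" if "s \<in> ?\<sigma>" for s
    proof -
      obtain t where s: "s = f a + t *\<^sub>R (f b - f a)"
        using \<open>s \<in> ?\<sigma>\<close> by (auto simp: in_segment algebra_simps)
      have "cnj u * (\<phi> b - \<phi> a) = norm (\<phi> b - \<phi> a) * (cnj u * u)"
        by (subst ba) (simp only: mult_ac)
      then have "Im (cnj u * (\<phi> b - \<phi> a)) = 0" by (simp add: uu)
      then have "Im (cnj u * f b) = Im (cnj u * f a)"
        by (simp only: Im_eq) (simp add: algebra_simps)
      moreover have "cnj u * s = cnj u * f a + t *\<^sub>R (cnj u * f b - cnj u * f a)"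
        by (simp add: s algebra_simps)
      ultimately show ?thesis by (simp only: plus_complex.sel minus_complex.sel scaleR_complex.sel Im_eq) simp
    qed
    \<comment> \<open>\<open>R\<close> is the component of \<open>\<phi>\<close> along
      \<open>u\<close>, transported to the segment by the inverse \<open>k\<close>. Connectedness
      makes it attain every intermediate value, and the component across \<open>u\<close> already
      agrees.\<close>
    define R where "R = (\<lambda>s. Re (cnj u * \<phi> (k s)))"
    have "continuous_on ?\<sigma> R"
      unfolding R_def
      by (intro continuous_intros continuous_on_compose2[OF \<phi>_cont] continuous_on_subset[OF k_cont] \<sigma>)
        (use \<sigma> k in auto)
    then have conn: "connected (R ` ?\<sigma>)"
      by (intro connected_continuous_image) auto
    show ?thesis
    proof
      fix w assume "w \<in> closed_segment (\<phi> a) (\<phi> b)"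
      then obtain t where t: "0 \<le> t" "t \<le> 1" "w = \<phi> a + t *\<^sub>R (\<phi> b - \<phi> a)"
        by (auto simp: in_segment algebra_simps)
      have "cnj u * w = cnj u * \<phi> a + t * norm (\<phi> b - \<phi> a) * (cnj u * u)"
        by (simp only: t(3)) (subst ba, simp add: algebra_simps scaleR_conv_of_real)
      then have w: "cnj u * w = cnj u * \<phi> a + complex_of_real (t * norm (\<phi> b - \<phi> a))"
        by (simp add: uu)
      have "cnj u * \<phi> b = cnj u * \<phi> a + norm (\<phi> b - \<phi> a) * (cnj u * u)"
        using ba by (metis add_diff_cancel_left' diff_add_cancel distrib_left mult.left_commute)
      then have b: "cnj u * \<phi> b = cnj u * \<phi> a + complex_of_real (norm (\<phi> b - \<phi> a))"
        by (simp add: uu)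
      have "{R (f a)..R (f b)} \<subseteq> R ` ?\<sigma>"
        by (rule connected_contains_Icc[OF conn]) auto
      moreover have "Re (cnj u * w) \<in> {R (f a)..R (f b)}"
        using t(1,2) ab by (simp add: R_def k w b mult_left_le_one_le del: times_complex.sel of_real_mult flip: of_real_mult)
      ultimately obtain s where s: "s \<in> ?\<sigma>" "Re (cnj u * w) = Re (cnj u * \<phi> (k s))"
        by (auto simp: R_def)
      obtain z where z: "z \<in> ball 0 1" "s = f z" using s(1) \<sigma> by auto
      have "Im (cnj u * w) = Im (cnj u * \<phi> z)"
        using Im_\<sigma>[OF s(1)] by (simp add: w z(2) Im_eq del: times_complex.sel of_real_mult flip: of_real_mult)
      then have "cnj u * w = cnj u * \<phi> z"
        using s(2) z by (simp add: complex_eq_iff k)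
      then have "w = \<phi> z" using u by auto
      with z show "w \<in> \<phi> ` ball 0 1" by blast
    qed
  qed
  then show ?thesis
    unfolding \<phi>_def[symmetric] by (auto simp: convex_contains_segment)
qed

section \<open>Coefficient bound and distance to the boundary\<close>

lemma has_field_derivative_0: "(h has_field_derivative 1) (at 0)" "(g has_field_derivative 0) (at 0)"
  using field_differentiable[of 0] normalized
  by (simp_all add: DERIV_deriv_iff_field_differentiable[symmetric])

text \<open>For the aligning \<open>\<nu>\<close> the sum of moduli is the modulus of one
  coefficient of \<open>h + \<nu> g\<close>, which is normalized because \<open>g\<close> and its
  derivative vanish at 0.\<close>

lemma coefficient_bound:
  assumes n: "n \<ge> 1"
  shows "norm (tcoeff h n) + norm (tcoeff g n) \<le> 1"
proof -
  obtain \<nu> where \<nu>: "norm \<nu> = 1"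
      "norm (tcoeff h n + \<nu> * tcoeff g n) = norm (tcoeff h n) + norm (tcoeff g n)"
    by (rule aligning_unit)
  have D: "((\<lambda>z. h z + \<nu> * g z) has_field_derivative 1) (at 0)"
    using DERIV_add[OF has_field_derivative_0(1) DERIV_cmult[OF has_field_derivative_0(2), of \<nu>]] by simp
  have "norm (tcoeff (\<lambda>z. h z + \<nu> * g z) n) \<le> 1"
    by (rule convex_univalent_coefficient_bound[OF _ analytic_inj analytic_convex _ _ n])
      (auto intro!: holomorphic_intros hol simp: normalized \<nu>(1) DERIV_imp_deriv[OF D])
  moreover have "tcoeff (\<lambda>z. h z + \<nu> * g z) n = tcoeff h n + \<nu> * tcoeff g n"
  proof -
    have "(deriv ^^ n) (\<lambda>z. h z + \<nu> * g z) 0 = (deriv ^^ n) h 0 + (deriv ^^ n) (\<lambda>z. \<nu> * g z) 0"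
      by (rule higher_deriv_add[where S = "ball 0 1"]) (auto intro!: holomorphic_intros hol)
    also have "(deriv ^^ n) (\<lambda>z. \<nu> * g z) 0 = \<nu> * (deriv ^^ n) g 0"
      by (rule higher_deriv_cmult[where A = "ball 0 1"]) (auto intro!: hol)
    finally show ?thesis by (simp add: tcoeff_def add_divide_distrib)
  qed
  ultimately show ?thesis using \<nu>(2) by simp
qed

text \<open>For an omitted point \<open>w\<close>, a separating line gives
  \<open>a \<bullet> f z \<le> b \<le> a \<bullet> w\<close>. The derivative bound for nonnegative
  real part yields \<open>norm a \<le> 2 * b\<close>, whereas Cauchy-Schwarz gives
  \<open>2 * b < norm a\<close>.\<close>

lemma ball_half_subset: "ball 0 (1/2) \<subseteq> (\<lambda>z. h z + cnj (g z)) ` ball 0 1"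
proof (rule ccontr)
  define f where "f = (\<lambda>z. h z + cnj (g z))"
  assume "\<not> ?thesis"
  then obtain w where w: "norm w < 1/2" "w \<notin> f ` ball 0 1"
    unfolding subset_eq f_def by auto
  have "convex (f ` ball 0 1)" using stable_convex[of 1] by (simp add: f_def)
  then obtain a b where "a \<noteq> 0" "\<forall>z\<in>ball 0 1. a \<bullet> f z \<le> b" "b \<le> a \<bullet> w"
    using separating_hyperplane_sets[of "f ` ball 0 1" "{w}"] w(2) by auto
  then have ab: "\<And>z. norm z < 1 \<Longrightarrow> a \<bullet> f z \<le> b" "b \<le> a \<bullet> w" by auto
  \<comment> \<open>Conjugating the term with \<open>g\<close> preserves its real part, so the
    harmonic function \<open>- (a \<bullet> f z)\<close> is the real part of an analytic
    one.\<close>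
  define P where "P = (\<lambda>z. - (cnj a * h z + a * g z))"
  have Re_P: "Re (P z) = - (a \<bullet> f z)" for z
    by (simp add: P_def f_def inner_complex_def algebra_simps)
  have b: "b \<ge> 0" using ab(1)[of 0] by (simp add: f_def normalized)
  \<comment> \<open>Only \<open>b \<ge> 0\<close> is known, while the derivative bound asks for a
    positive value at 0; hence \<open>c > b\<close> and a limit afterwards.\<close>
  have "norm a \<le> 2 * c" if "c > b" for c
  proof -
    have D: "((\<lambda>z. P z + c) has_field_derivative - cnj a) (at 0)"
      unfolding P_def
      by (auto intro!: derivative_eq_intros has_field_derivative_0)
    have "norm (deriv (\<lambda>z. P z + c) 0) \<le> 2 * c"
    proof (rule deriv_at_0_le_if_Re_nonneg)
      show "(\<lambda>z. P z + c) holomorphic_on ball 0 1"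
        unfolding P_def by (intro holomorphic_intros hol)
      show "0 \<le> Re (P z + c)" if "norm z < 1" for z
        using ab(1)[OF that] \<open>c > b\<close> by (simp add: Re_P)
      show "P 0 + c = c" by (simp add: P_def normalized)
    qed (use b that in simp)
    then show ?thesis by (simp add: DERIV_imp_deriv[OF D])
  qed
  then have "norm a \<le> 2 * b"
    using dense_ge[of b "norm a / 2"] by fastforce
  also have "\<dots> \<le> 2 * (norm a * norm w)"
    using ab(2) norm_cauchy_schwarz[of a w] by linarith
  also have "\<dots> < norm a" using w(1) \<open>a \<noteq> 0\<close> by simp
  finally show False by simp
qed

text \<open>Since \<open>g\<close> contracts distances relative to \<open>h\<close>, the map \<open>f \<circ> h\<inverse>\<close> is Lipschitz, hence bounded
  near a finite boundary point of the image of \<open>h\<close>. The frontier must be shown nonempty because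
  \<open>infdist\<close> to the empty set is 0.\<close>

lemma image_neq_UNIV: "(\<lambda>z. h z + cnj (g z)) ` ball 0 1 \<noteq> UNIV"
proof
  define f where "f = (\<lambda>z. h z + cnj (g z))"
  assume "(\<lambda>z. h z + cnj (g z)) ` ball 0 1 = UNIV"
  then have f_surj: "f ` ball 0 1 = UNIV" by (simp add: f_def)
  have h_inj: "inj_on h (ball 0 1)"
    using increments_norm_less by (fastforce simp: inj_on_def)
  have f_cont: "continuous_on (ball 0 1) f"
    unfolding f_def by (intro continuous_intros holomorphic_on_imp_continuous_on hol)
  obtain k where "homeomorphism (ball 0 1) (f ` ball 0 1) f k"
    using invariance_of_domain_homeomorphism[OF _ f_cont] stable_inj[of 1] by (auto simp: f_def)
  then have k_cont: "continuous_on UNIV k" and k: "\<And>z. z \<in> ball 0 1 \<Longrightarrow> k (f z) = z"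
    and k_in: "\<And>w. k w \<in> ball 0 1"
    using f_surj by (auto simp: homeomorphism_def)
  have h_open: "open (h ` ball 0 1)"
    by (rule open_mapping_thm3[OF hol(1) _ h_inj]) simp
  have "h ` ball 0 1 \<noteq> UNIV"
  proof
    \<comment> \<open>The inverse of \<open>h\<close> would be a bounded nonconstant entire
      function.\<close>
    assume h_surj: "h ` ball 0 1 = UNIV"
    obtain \<gamma> where \<gamma>: "\<gamma> holomorphic_on UNIV" "\<And>z. z \<in> ball 0 1 \<Longrightarrow> \<gamma> (h z) = z"
      using holomorphic_has_inverse[OF hol(1) open_ball h_inj] h_surj by metis
    have "range \<gamma> \<subseteq> ball 0 1" using \<gamma>(2) h_surj by (metis image_iff image_subsetI UNIV_I)
    then have "\<gamma> constant_on UNIV"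
      by (intro Liouville_theorem \<gamma>(1)) (use bounded_ball bounded_subset in blast)
    then obtain c where "\<And>w. \<gamma> w = c" by (auto simp: constant_on_def)
    with \<gamma>(2)[of 0] \<gamma>(2)[of "1/2"] show False by simp
  qed
  then obtain w where w: "w \<in> frontier (h ` ball 0 1)"
    using frontier_not_empty[of "h ` ball 0 1"] by auto
  then have w_cl: "w \<in> closure (h ` ball 0 1)" and w_notin: "w \<notin> h ` ball 0 1"
    using h_open by (auto simp: frontier_def interior_open)
  obtain y where y: "\<And>n. y n \<in> h ` ball 0 1" "y \<longlonglongrightarrow> w"
    using w_cl by (auto simp: closure_sequential)
  then obtain z where z: "\<And>n. z n \<in> ball 0 1" "\<And>n. h (z n) = y n"
    unfolding image_iff by metis
  have lip: "dist (f a) (f b) \<le> 2 * dist (h a) (h b)" if "a \<in> ball 0 1" "b \<in> ball 0 1" for a b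
  proof (cases "a = b")
    case False
    have "f a - f b = (h a - h b) + cnj (g a - g b)" by (simp add: f_def)
    then have "norm (f a - f b) \<le> norm (h a - h b) + norm (g a - g b)"
      by (metis complex_mod_cnj norm_triangle_ineq)
    then show ?thesis
      using increments_norm_less[of a b] that False by (simp add: dist_norm)
  qed simp
  have "Cauchy (\<lambda>n. f (z n))"
  proof (rule metric_CauchyI)
    fix e :: real assume "e > 0"
    then obtain M where M: "\<And>m n. m \<ge> M \<Longrightarrow> n \<ge> M \<Longrightarrow> dist (y m) (y n) < e / 2"
      using LIMSEQ_imp_Cauchy[OF y(2)] by (metis metric_CauchyD half_gt_zero)
    have "dist (f (z m)) (f (z n)) < e" if "m \<ge> M" "n \<ge> M" for m n
      using lip[OF z(1)[of m] z(1)[of n]] M[OF that] by (simp add: z(2))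
    then show "\<exists>M. \<forall>m\<ge>M. \<forall>n\<ge>M. dist (f (z m)) (f (z n)) < e" by blast
  qed
  then obtain v where "(\<lambda>n. f (z n)) \<longlonglongrightarrow> v"
    using Cauchy_convergent convergent_def by blast
  \<comment> \<open>Since \<open>f\<close> is assumed onto, \<open>k v\<close> lies in the disc.
    Then \<open>z\<close> converges to it, and \<open>w\<close> would be a value of
    \<open>h\<close>.\<close>
  then have "(\<lambda>n. k (f (z n))) \<longlonglongrightarrow> k v"
    by (intro continuous_on_tendsto_compose[OF k_cont]) auto
  then have "z \<longlonglongrightarrow> k v" by (simp add: k[OF z(1)])
  then have "(\<lambda>n. h (z n)) \<longlonglongrightarrow> h (k v)"
    by (intro continuous_on_tendsto_compose[OF holomorphic_on_imp_continuous_on[OF hol(1)]])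
      (use k_in z(1) in auto)
  then have "y \<longlonglongrightarrow> h (k v)" by (simp add: z(2))
  then have "w = h (k v)" using y(2) LIMSEQ_unique by blast
  with w_notin k_in show False by blast
qed

lemma bdist_ge_half: "bdist (\<lambda>z. h z + cnj (g z)) \<ge> 1/2"
proof -
  let ?\<Omega> = "(\<lambda>z. h z + cnj (g z)) ` ball 0 1"
  have "frontier ?\<Omega> \<noteq> {}"
    using image_neq_UNIV by (intro frontier_not_empty) auto
  moreover have "1/2 \<le> dist 0 a" if "a \<in> frontier ?\<Omega>" for a
  proof (rule ccontr)
    assume "\<not> 1/2 \<le> dist 0 a"
    then have "a \<in> interior ?\<Omega>"
      using interior_maximal[OF ball_half_subset] by auto
    with that show False by (simp add: frontier_def)
  qed
  ultimately have "1/2 \<le> (INF a\<in>frontier ?\<Omega>. dist 0 a)"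
    by (rule cINF_greatest)
  with \<open>frontier ?\<Omega> \<noteq> {}\<close> show ?thesis
    by (simp add: bdist_def normalized infdist_notempty)
qed

end

section \<open>The half-plane map\<close>

text \<open>The line \<open>Re v = - 1/2\<close> is the perpendicular bisector of 0 and -1.\<close>

lemma Re_gt_minus_half_iff: "Re v > - 1/2 \<longleftrightarrow> norm v < norm (1 + v)"
proof -
  have "norm v < norm (1 + v) \<longleftrightarrow> (norm v)\<^sup>2 < (norm (1 + v))\<^sup>2"
    by (auto intro: power_strict_mono power_less_imp_less_base)
  also have "\<dots> \<longleftrightarrow> Re v > - 1/2"
    by (simp add: cmod_power2) (auto simp: power2_eq_square algebra_simps)
  finally show ?thesis ..
qed

text \<open>The inverse is \<open>v / (1 + v)\<close>, which lies in the disc exactly when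
  \<open>v\<close> is closer to 0 than to -1.\<close>

lemma half_plane_map_image: "(\<lambda>z. z / (1 - z)) ` ball 0 1 = {v. Re v > - 1/2}"
proof (intro equalityI subsetI)
  fix v assume "v \<in> (\<lambda>z. z / (1 - z)) ` ball (0::complex) 1"
  then obtain z where z: "norm z < 1" "v = z / (1 - z)" by auto
  then have "1 - z \<noteq> 0" by auto
  then have "1 + v = 1 / (1 - z)" by (simp add: z(2) field_simps)
  with z \<open>1 - z \<noteq> 0\<close> have "norm v < norm (1 + v)"
    by (simp add: norm_divide divide_strict_right_mono)
  then show "v \<in> {v. Re v > - 1/2}" by (simp only: Re_gt_minus_half_iff mem_Collect_eq)
next
  fix v assume "v \<in> {v. Re v > - 1/2}"
  then have v: "norm v < norm (1 + v)" by (simp only: Re_gt_minus_half_iff mem_Collect_eq)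
  then have nz: "1 + v \<noteq> 0" by auto
  have "1 - v / (1 + v) = 1 / (1 + v)" using nz by (simp add: field_simps)
  then have "v = v / (1 + v) / (1 - v / (1 + v))" using nz by simp
  moreover have "v / (1 + v) \<in> ball 0 1"
    using v nz by (simp add: norm_divide divide_less_eq)
  ultimately show "v \<in> (\<lambda>z. z / (1 - z)) ` ball 0 1" by blast
qed

lemma half_plane_map_holomorphic: "(\<lambda>z. z / (1 - z)) holomorphic_on ball 0 1"
  by (intro holomorphic_intros) auto

lemma half_plane_map_deriv:
  fixes z :: complex
  assumes "norm z < 1"
  shows "deriv (\<lambda>z. z / (1 - z)) z = 1 / (1 - z)\<^sup>2"
    and "deriv (deriv (\<lambda>z. z / (1 - z))) z = 2 / (1 - z) ^ 3"
proof -
  have 1: "deriv (\<lambda>z. z / (1 - z)) z = 1 / (1 - z)\<^sup>2" if "norm z < 1" for z :: complex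
  proof -
    from that have "z \<noteq> 1" by auto
    then show ?thesis
      by (intro DERIV_imp_deriv)
        (auto intro!: derivative_eq_intros simp: field_simps power2_eq_square)
  qed
  from 1[OF assms] show "deriv (\<lambda>z. z / (1 - z)) z = 1 / (1 - z)\<^sup>2" .
  from assms have "z \<noteq> 1" by auto
  then have "((\<lambda>z. 1 / (1 - z)\<^sup>2) has_field_derivative 2 / (1 - z) ^ 3) (at z)"
    by (auto intro!: derivative_eq_intros simp: divide_simps power2_eq_square power3_eq_cube)
  then have "(deriv (\<lambda>z. z / (1 - z)) has_field_derivative 2 / (1 - z) ^ 3) (at z)"
    by (rule has_field_derivative_transform_within_open[where S = "ball 0 1"])
      (use assms 1 in auto)
  then show "deriv (deriv (\<lambda>z. z / (1 - z))) z = 2 / (1 - z) ^ 3"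
    by (rule DERIV_imp_deriv)
qed

lemma half_plane_map_second_order:
  fixes z :: complex
  assumes "norm z < 1"
  shows "z * deriv (\<lambda>z. z / (1 - z)) z + z\<^sup>2 * deriv (deriv (\<lambda>z. z / (1 - z))) z =
    z * (1 + z) / (1 - z) ^ 3"
proof -
  from assms have "1 - z \<noteq> 0" by auto
  then have "z * (1 / (1 - z)\<^sup>2) = z * (1 - z) / (1 - z) ^ 3"
    by (simp add: power2_eq_square power3_eq_cube)
  then show ?thesis
    unfolding half_plane_map_deriv[OF assms]
    by (simp flip: add_divide_distrib) (simp add: power2_eq_square algebra_simps)
qed

lemma half_plane_map_tcoeff: "tcoeff (\<lambda>z. z / (1 - z)) n = (if n = 0 then 0 else 1)"
proof -
  have "(\<lambda>z :: complex. z * inverse (1 - z)) has_fps_expansion fps_X * inverse (1 - fps_X)"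
    by (intro fps_expansion_intros) auto
  then have "tcoeff (\<lambda>z. z / (1 - z)) n = fps_nth (fps_X * inverse (1 - fps_X)) n"
    by (simp only: fps_nth_fps_expansion tcoeff_def divide_inverse)
  also have "\<dots> = (if n = 0 then 0 else 1)"
    by (simp add: fps_inverse_one_minus_fps_X)
  finally show ?thesis .
qed

text \<open>With \<open>g = 0\<close> every \<open>h + \<mu> cnj g\<close> is \<open>h\<close>
  itself, whose image is a half-plane.\<close>

lemma half_plane_map_stable_convex: "stable_convex_S0H (\<lambda>z. z / (1 - z)) (\<lambda>_. 0)"
proof -
  have "inj_on (\<lambda>z. z / (1 - z)) (ball (0 :: complex) 1)"
  proof (rule inj_onI)
    fix x y :: complex assume "x \<in> ball 0 1" "y \<in> ball 0 1" and eq: "x / (1 - x) = y / (1 - y)"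
    then have "1 - x \<noteq> 0" "1 - y \<noteq> 0" by auto
    with eq show "x = y" by (simp add: field_simps)
  qed
  moreover have "deriv (\<lambda>z. z / (1 - z)) z \<noteq> (0 :: complex)" if "norm z < 1" for z
    using that by (auto simp: half_plane_map_deriv)
  ultimately show ?thesis
    unfolding stable_convex_S0H_def
    by (auto simp: half_plane_map_holomorphic half_plane_map_image half_plane_map_deriv
        convex_halfspace_Re_gt)
qed

text \<open>The frontier point \<open>- 1/2\<close> bounds the distance from above, which is the
  direction that sharpness requires.\<close>

lemma half_plane_map_bdist: "bdist (\<lambda>z. z / (1 - z)) \<le> 1/2"
proof -
  have "frontier {v. Re v > - 1/2} = {v. Re v = - 1/2}"
    using frontier_halfspace_gt[of "1 :: complex" "- 1/2"] by (simp add: inner_complex_def)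
  then have "- 1/2 \<in> frontier ((\<lambda>z. z / (1 - z)) ` ball (0 :: complex) 1)"
    by (simp only: half_plane_map_image) simp
  then show ?thesis
    unfolding bdist_def by (rule infdist_le2) simp
qed

section \<open>Majorant series\<close>

text \<open>This is the second-order expansion of the half-plane map at a real point, as its
  coefficients from index 1 on are all 1.\<close>

lemma square_power_sums:
  fixes x :: real
  assumes "0 \<le> x" "x < 1"
  shows "(\<lambda>n. real (n ^ 2) * x ^ n) sums (x * (1 + x) / (1 - x) ^ 3)"
proof -
  have x: "norm (complex_of_real x) < 1" using assms by simp
  have "(\<lambda>n. of_nat (n ^ 2) * tcoeff (\<lambda>z. z / (1 - z)) n * complex_of_real x ^ n)
      sums (complex_of_real x * (1 + complex_of_real x) / (1 - complex_of_real x) ^ 3)"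
    using second_order_sums[OF half_plane_map_holomorphic x]
    unfolding half_plane_map_second_order[OF x] .
  also have "(\<lambda>n. of_nat (n ^ 2) * tcoeff (\<lambda>z. z / (1 - z)) n * complex_of_real x ^ n) =
      (\<lambda>n. complex_of_real (real (n ^ 2) * x ^ n))"
    by (auto simp: fun_eq_iff half_plane_map_tcoeff)
  also have "complex_of_real x * (1 + complex_of_real x) / (1 - complex_of_real x) ^ 3 =
      complex_of_real (x * (1 + x) / (1 - x) ^ 3)"
    by simp
  finally show ?thesis by (simp only: sums_of_real_iff)
qed

lemma power_tail_sums:
  fixes x :: real
  assumes "0 \<le> x" "x < 1"
  shows "(\<lambda>k. x ^ (k + N)) sums (x ^ N / (1 - x))"
  using sums_mult[OF geometric_sums[of x], of "x ^ N"] assms by (simp add: power_add mult_ac)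

context stable_convex
begin

lemma second_order_bound:
  assumes w: "norm w < 1"
  shows "norm (w * deriv h w + w\<^sup>2 * deriv (deriv h) w +
      cnj (w * deriv g w + w\<^sup>2 * deriv (deriv g) w))
    \<le> norm w * (1 + norm w) / (1 - norm w) ^ 3"
proof (rule norm_sums_le)
  let ?t = "\<lambda>F n. of_nat (n ^ 2) * tcoeff F n * w ^ n"
  show "(\<lambda>n. ?t h n + cnj (?t g n)) sums (w * deriv h w + w\<^sup>2 * deriv (deriv h) w +
      cnj (w * deriv g w + w\<^sup>2 * deriv (deriv g) w))"
    by (intro sums_add sums_cnj[THEN iffD2] second_order_sums hol w)
  show "(\<lambda>n. real (n ^ 2) * norm w ^ n) sums (norm w * (1 + norm w) / (1 - norm w) ^ 3)"
    by (rule square_power_sums) (use w in auto)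
  fix n
  have "norm (?t h n + cnj (?t g n)) \<le> norm (?t h n) + norm (?t g n)"
    by (metis complex_mod_cnj norm_triangle_ineq)
  also have "\<dots> = (norm (tcoeff h n) + norm (tcoeff g n)) * (real (n ^ 2) * norm w ^ n)"
    by (simp add: norm_mult norm_power algebra_simps del: of_nat_power)
  \<comment> \<open>The coefficient bound starts at \<open>n = 1\<close>; at \<open>n = 0\<close>
    the factor \<open>n ^ 2\<close> removes the term.\<close>
  also have "\<dots> \<le> real (n ^ 2) * norm w ^ n"
  proof (cases "n = 0")
    case False
    then show ?thesis
      using coefficient_bound[of n] by (intro mult_left_le_one_le) auto
  qed simp
  finally show "norm (?t h n + cnj (?t g n)) \<le> real (n ^ 2) * norm w ^ n" .
qed

lemma tail_sum_bound:
  assumes w: "norm w < 1" and "N \<ge> 1"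
  shows "tail_sum h g N w \<le> norm w ^ N / (1 - norm w)"
proof -
  have S: "(\<lambda>k. norm w ^ (k + N)) sums (norm w ^ N / (1 - norm w))"
    by (rule power_tail_sums) (use w in auto)
  have le: "(norm (tcoeff h (k + N)) + norm (tcoeff g (k + N))) * norm w ^ (k + N) \<le> norm w ^ (k + N)" for k
    using coefficient_bound[of "k + N"] \<open>N \<ge> 1\<close> by (intro mult_left_le_one_le) auto
  \<comment> \<open>Convergence has to come first: only then is the \<open>suminf\<close> in
    \<open>tail_sum\<close> the limit of the partial sums.\<close>
  then have "summable (\<lambda>k. (norm (tcoeff h (k + N)) + norm (tcoeff g (k + N))) * norm w ^ (k + N))"
    by (intro summable_comparison_test[OF _ sums_summable[OF S]]) auto
  then have "tail_sum h g N w \<le> (\<Sum>k. norm w ^ (k + N))"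
    unfolding tail_sum_def by (intro suminf_le le sums_summable[OF S])
  with S show ?thesis by (simp add: sums_iff)
qed

end

section \<open>The radius \<open>r8\<close>\<close>

lemma square_power_sum_strict_mono:
  fixes x y :: real
  assumes "0 \<le> x" "x < y" "y < 1"
  shows "x * (1 + x) / (1 - x) ^ 3 < y * (1 + y) / (1 - y) ^ 3"
  using assms by (intro frac_less mult_strict_mono power_mono mult_nonneg_nonneg) auto

lemma power_tail_mono:
  fixes x y :: real
  assumes "0 \<le> x" "x \<le> y" "y < 1"
  shows "x ^ N / (1 - x) \<le> y ^ N / (1 - y)"
  using assms by (intro frac_le power_mono) auto

lemma F8_altdef:
  "F8 m p N r = r ^ m * (1 + r ^ m) / (1 - r ^ m) ^ 3 + (r ^ p) ^ N / (1 - r ^ p) - 1 / 2"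
  by (simp add: F8_def power_mult)

text \<open>Strictness comes from the first summand. It gives uniqueness of the root, the estimate
  below it and failure beyond it.\<close>

lemma F8_strict_mono:
  assumes "m \<ge> 1" "p \<ge> 1" "0 \<le> r" "r < s" "s < 1"
  shows "F8 m p N r < F8 m p N s"
proof -
  have "r ^ m < s ^ m" "s ^ m < 1" "r ^ p \<le> s ^ p" "s ^ p < 1"
    using assms by (auto intro: power_strict_mono power_mono simp: power_less_one_iff)
  then show ?thesis
    unfolding F8_altdef
    using square_power_sum_strict_mono[of "r ^ m" "s ^ m"] power_tail_mono[of "r ^ p" "s ^ p" N] assms(3)
    by simp
qed

lemma F8_ex1_root:
  assumes "m \<ge> 1" "p \<ge> 1" "N \<ge> 1"
  shows "\<exists>!r. 0 < r \<and> r < 1 \<and> F8 m p N r = 0"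
proof (rule ex_ex1I)
  \<comment> \<open>At \<open>R ^ m = 1/2\<close> the first summand of \<open>F8\<close> equals 6,
    so \<open>F8\<close> has changed sign, and \<open>R < 1\<close> keeps the denominators nonzero
    on \<open>{0..R}\<close>.\<close>
  define R where "R = root m (1/2)"
  have R: "0 < R" "R < 1" "R ^ m = 1/2"
    using assms by (simp_all add: R_def)
  have nz: "r ^ k \<noteq> 1" if "k \<ge> 1" "0 \<le> r" "r \<le> R" for k and r :: real
    using that R(2) power_less_one_iff[of r k] by fastforce
  have "continuous_on {0..R} (F8 m p N)"
    unfolding F8_def using nz assms by (intro continuous_intros) auto
  moreover have "F8 m p N 0 = - 1/2" using assms by (simp add: F8_def power_0_left)
  moreover have "F8 m p N R \<ge> 0"
  proof -
    have "R ^ (p * N) / (1 - R ^ p) \<ge> 0"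
      using R by (intro divide_nonneg_nonneg) (auto simp: power_le_one)
    then show ?thesis by (simp add: F8_def R(3) power3_eq_cube)
  qed
  ultimately obtain r where r: "0 \<le> r" "r \<le> R" "F8 m p N r = 0"
    using IVT'[of "F8 m p N" 0 0 R] R by auto
  with \<open>F8 m p N 0 = - 1/2\<close> have "0 < r" "r < 1" using R(2) by (auto simp: less_le)
  with r show "\<exists>r. 0 < r \<and> r < 1 \<and> F8 m p N r = 0" by blast
  show "r = s" if "0 < r \<and> r < 1 \<and> F8 m p N r = 0" "0 < s \<and> s < 1 \<and> F8 m p N s = 0" for r s
    using F8_strict_mono[of m p r s N] F8_strict_mono[of m p s r N] assms that
    by (cases r s rule: linorder_cases) auto
qed

lemma r8_root:
  assumes "m \<ge> 1" "p \<ge> 1" "N \<ge> 1"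
  shows "0 < r8 m p N" "r8 m p N < 1" "F8 m p N (r8 m p N) = 0"
  using theI'[OF F8_ex1_root[OF assms]] by (simp_all add: r8_def)

section \<open>The inequality and its sharpness\<close>

text \<open>The Schwarz lemma replaces the moduli of \<open>\<omega>m z\<close> and
  \<open>\<omega>p z\<close> by powers of \<open>norm z\<close> in increasing majorants. The total
  is \<open>F8 m p N (norm z) + 1/2\<close>, at most \<open>1/2\<close> up to the root.\<close>

lemma bohr_inequality:
  assumes "m \<ge> 1" "p \<ge> 1" "N \<ge> 1" and sc: "stable_convex_S0H h g"
    and \<omega>: "\<omega>m \<in> Bcls m" "\<omega>p \<in> Bcls p" and z: "norm z \<le> r8 m p N"
  defines "f \<equiv> (\<lambda>w. h w + cnj (g w))"
  shows "norm (Dop (Dop f) (\<omega>m z)) + tail_sum h g N (\<omega>p z) \<le> bdist f"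
    and "norm (Dscr (Dscr f) (\<omega>m z)) + tail_sum h g N (\<omega>p z) \<le> bdist f"
proof -
  interpret stable_convex h g by (unfold_locales) (rule sc)
  note root = r8_root[OF assms(1-3)]
  have z1: "norm z < 1" using z root by simp
  have less1: "norm z ^ m < 1" "norm z ^ p < 1"
    using z1 assms(1,2) by (auto simp: power_less_one_iff)
  have w: "norm (\<omega>m z) \<le> norm z ^ m" "norm (\<omega>p z) \<le> norm z ^ p"
    using Bcls_bound \<omega> z1 by auto
  define E where "E = (\<lambda>F (w::complex). w * deriv F w + w\<^sup>2 * deriv (deriv F) w)"
  have "norm (E h (\<omega>m z) + cnj (E g (\<omega>m z))) \<le> norm (\<omega>m z) * (1 + norm (\<omega>m z)) / (1 - norm (\<omega>m z)) ^ 3"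
    unfolding E_def using w less1 by (intro second_order_bound) auto
  also have "\<dots> \<le> norm z ^ m * (1 + norm z ^ m) / (1 - norm z ^ m) ^ 3"
    using square_power_sum_strict_mono[of "norm (\<omega>m z)" "norm z ^ m"] w(1) less1(1)
    by (cases "norm (\<omega>m z) = norm z ^ m") auto
  finally have 1: "norm (E h (\<omega>m z) + cnj (E g (\<omega>m z))) \<le> \<dots>" .
  have "tail_sum h g N (\<omega>p z) \<le> norm (\<omega>p z) ^ N / (1 - norm (\<omega>p z))"
    using w less1 assms(3) by (intro tail_sum_bound) auto
  also have "\<dots> \<le> (norm z ^ p) ^ N / (1 - norm z ^ p)"
    by (intro power_tail_mono w less1) auto
  finally have "norm (E h (\<omega>m z) + cnj (E g (\<omega>m z))) + tail_sum h g N (\<omega>p z) \<le> F8 m p N (norm z) + 1/2"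
    using 1 by (simp add: F8_altdef)
  also have "F8 m p N (norm z) \<le> F8 m p N (r8 m p N)"
    using F8_strict_mono[OF assms(1,2), of "norm z" "r8 m p N" N] z root by (cases "norm z = r8 m p N") auto
  also have "F8 m p N (r8 m p N) + 1/2 \<le> bdist f"
    using bdist_ge_half by (simp add: root f_def)
  finally have "norm (E h (\<omega>m z) + cnj (E g (\<omega>m z))) + tail_sum h g N (\<omega>p z) \<le> bdist f" by simp
  moreover have "\<omega>m z \<in> ball 0 1" using w(1) less1(1) by simp
  then have "Dop (Dop f) (\<omega>m z) = E h (\<omega>m z) + cnj (E g (\<omega>m z))"
      "Dscr (Dscr f) (\<omega>m z) = E h (\<omega>m z) + cnj (E g (\<omega>m z))"
    unfolding E_def using hol
    by (intro second_order_operators[where S = "ball 0 1"]; simp add: f_def)+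
  ultimately show "norm (Dop (Dop f) (\<omega>m z)) + tail_sum h g N (\<omega>p z) \<le> bdist f"
      "norm (Dscr (Dscr f) (\<omega>m z)) + tail_sum h g N (\<omega>p z) \<le> bdist f" by simp_all
qed

text \<open>At the real point \<open>r\<close> the majorants are attained, so the left side is
  exactly \<open>F8 m p N r + 1/2\<close>, which exceeds \<open>1/2\<close> beyond the root.\<close>

lemma bohr_inequality_sharp:
  assumes "m \<ge> 1" "p \<ge> 1" "N \<ge> 1" and r: "r8 m p N < r" "r < 1"
  defines "h \<equiv> \<lambda>z::complex. z / (1 - z)" and "g \<equiv> \<lambda>_. 0 :: complex"
  defines "f \<equiv> (\<lambda>w. h w + cnj (g w))" and "z \<equiv> complex_of_real r"
  shows "norm (Dop (Dop f) (z ^ m)) + tail_sum h g N (z ^ p) > bdist f"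
    and "norm (Dscr (Dscr f) (z ^ m)) + tail_sum h g N (z ^ p) > bdist f"
proof -
  note root = r8_root[OF assms(1-3)]
  have r0: "0 < r" using r root by simp
  have less1: "r ^ m < 1" "r ^ p < 1"
    using r0 r assms(1,2) by (auto simp: power_less_one_iff)
  have in_ball: "z ^ m \<in> ball 0 1" using less1 r0 by (simp add: z_def norm_power)
  have f: "f w = h w + cnj (g w)" for w by (simp add: f_def)
  have "g holomorphic_on ball 0 1" "h holomorphic_on ball 0 1"
    unfolding g_def h_def by (auto intro: half_plane_map_holomorphic)
  note D = second_order_operators[OF open_ball in_ball this(2,1) f]
  have "z ^ m * deriv h (z ^ m) + (z ^ m)\<^sup>2 * deriv (deriv h) (z ^ m) =
      of_real (r ^ m * (1 + r ^ m) / (1 - r ^ m) ^ 3)"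
    unfolding h_def using half_plane_map_second_order[of "z ^ m"] in_ball by (simp add: z_def)
  then have D_eq: "Dop (Dop f) (z ^ m) = of_real (r ^ m * (1 + r ^ m) / (1 - r ^ m) ^ 3)"
      "Dscr (Dscr f) (z ^ m) = of_real (r ^ m * (1 + r ^ m) / (1 - r ^ m) ^ 3)"
    by (simp_all add: D) (simp_all add: g_def)
  have norm_eq: "norm (complex_of_real (r ^ m * (1 + r ^ m) / (1 - r ^ m) ^ 3)) =
      r ^ m * (1 + r ^ m) / (1 - r ^ m) ^ 3"
    unfolding norm_of_real using r0 less1 by (intro abs_of_nonneg divide_nonneg_nonneg) auto
  have "tcoeff g k = 0" for k
    by (simp add: tcoeff_def g_def higher_deriv_const)
  \<comment> \<open>As \<open>N \<ge> 1\<close>, the tail avoids the vanishing constant coefficient,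
    and all its coefficients of \<open>h\<close> are 1.\<close>
  then have "tail_sum h g N (z ^ p) = (\<Sum>k. (r ^ p) ^ (k + N))"
    using assms(3) r0 by (simp add: tail_sum_def h_def half_plane_map_tcoeff z_def norm_power)
  also have "\<dots> = (r ^ p) ^ N / (1 - r ^ p)"
    using power_tail_sums[of "r ^ p" N] r0 less1 by (simp add: sums_iff)
  finally have "r ^ m * (1 + r ^ m) / (1 - r ^ m) ^ 3 + tail_sum h g N (z ^ p) = F8 m p N r + 1/2"
    by (simp add: F8_altdef)
  moreover have "F8 m p N (r8 m p N) < F8 m p N r"
    using F8_strict_mono[OF assms(1,2), of "r8 m p N" r N] r root by simp
  moreover have "bdist f \<le> 1/2"
    using half_plane_map_bdist by (simp add: f_def h_def g_def)
  ultimately have "bdist f < r ^ m * (1 + r ^ m) / (1 - r ^ m) ^ 3 + tail_sum h g N (z ^ p)"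
    using root by simp
  then show "norm (Dop (Dop f) (z ^ m)) + tail_sum h g N (z ^ p) > bdist f"
      "norm (Dscr (Dscr f) (z ^ m)) + tail_sum h g N (z ^ p) > bdist f"
    by (simp_all only: D_eq norm_eq)
qed

theorem theorem4p4:
  fixes m p N :: nat
  assumes "m \<ge> 1" and "p \<ge> 1" and "N \<ge> 2"
  shows "(\<exists>!r. 0 < r \<and> r < 1 \<and> F8 m p N r = 0) \<and>
    (\<forall>h g \<omega>m \<omega>p z. stable_convex_S0H h g \<and> \<omega>m \<in> Bcls m \<and> \<omega>p \<in> Bcls p \<and>
        norm z \<le> r8 m p N \<longrightarrow>
       (let f = (\<lambda>w. h w + cnj (g w)) in
          norm (Dop (Dop f) (\<omega>m z)) + tail_sum h g N (\<omega>p z) \<le> bdist f \<and>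
          norm (Dscr (Dscr f) (\<omega>m z)) + tail_sum h g N (\<omega>p z) \<le> bdist f)) \<and>
    (\<forall>r. r8 m p N < r \<and> r < 1 \<longrightarrow>
       (\<exists>h g \<omega>m \<omega>p z. stable_convex_S0H h g \<and> \<omega>m \<in> Bcls m \<and> \<omega>p \<in> Bcls p \<and> norm z = r \<and>
          (let f = (\<lambda>w. h w + cnj (g w)) in
             norm (Dop (Dop f) (\<omega>m z)) + tail_sum h g N (\<omega>p z) > bdist f)) \<and>
       (\<exists>h g \<omega>m \<omega>p z. stable_convex_S0H h g \<and> \<omega>m \<in> Bcls m \<and> \<omega>p \<in> Bcls p \<and> norm z = r \<and>
          (let f = (\<lambda>w. h w + cnj (g w)) in
             norm (Dscr (Dscr f) (\<omega>m z)) + tail_sum h g N (\<omega>p z) > bdist f)))"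
proof (intro conjI allI impI)
  have N: "N \<ge> 1" using assms(3) by simp
  show "\<exists>!r. 0 < r \<and> r < 1 \<and> F8 m p N r = 0"
    by (rule F8_ex1_root[OF assms(1,2) N])
  show "let f = (\<lambda>w. h w + cnj (g w)) in
          norm (Dop (Dop f) (\<omega>m z)) + tail_sum h g N (\<omega>p z) \<le> bdist f \<and>
          norm (Dscr (Dscr f) (\<omega>m z)) + tail_sum h g N (\<omega>p z) \<le> bdist f"
    if "stable_convex_S0H h g \<and> \<omega>m \<in> Bcls m \<and> \<omega>p \<in> Bcls p \<and> norm z \<le> r8 m p N"
    for h g \<omega>m \<omega>p z
    unfolding Let_def using bohr_inequality[OF assms(1,2) N] that by blast
  fix r assume r: "r8 m p N < r \<and> r < 1"
  have norm_r: "norm (complex_of_real r) = r"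
    using r r8_root(1)[OF assms(1,2) N] by simp
  note sharp = bohr_inequality_sharp[OF assms(1,2) N r[THEN conjunct1] r[THEN conjunct2]]
  note witness = half_plane_map_stable_convex power_in_Bcls[of m] power_in_Bcls[of p] norm_r
  show "\<exists>h g \<omega>m \<omega>p z. stable_convex_S0H h g \<and> \<omega>m \<in> Bcls m \<and> \<omega>p \<in> Bcls p \<and> norm z = r \<and>
          (let f = (\<lambda>w. h w + cnj (g w)) in
             norm (Dop (Dop f) (\<omega>m z)) + tail_sum h g N (\<omega>p z) > bdist f)"
    \<comment> \<open>Unification with the facts in \<open>witness\<close> chooses the half-plane
      map, zero, the two powers and the real point \<open>r\<close>.\<close>
    unfolding Let_def by (intro exI conjI, (rule witness)+, rule sharp(1))
  show "\<exists>h g \<omega>m \<omega>p z. stable_convex_S0H h g \<and> \<omega>m \<in> Bcls m \<and> \<omega>p \<in> Bcls p \<and> norm z = r \<and>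
          (let f = (\<lambda>w. h w + cnj (g w)) in
             norm (Dscr (Dscr f) (\<omega>m z)) + tail_sum h g N (\<omega>p z) > bdist f)"
    unfolding Let_def by (intro exI conjI, (rule witness)+, rule sharp(2))
qed

end
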